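(* Let $G=(\mathcal{V},\mathcal{E})$ be a finite undirected graph with $\mathcal{V}=\{1,\dots,N\}$ and adjacency matrix $\mathbf{A}=[a_{ij}]$, let $v:\mathcal{V}\to(0,\infty)$ be a centrality metric, let $\mathbf{V}=\mathrm{diag}(v(1),\dots,v(N))$, and let $\mathbf{M}_G=\mathbf{V}^{-1}\mathbf{A}$. Then the following properties hold for the spectrum of $\mathbf{M}_G$: (1) If $G$ has multiple connected components $\mathcal{C}\subset\mathcal{V}$, where each connected component $\mathcal{C}$ induces a subgraph of $G$ denoted by $G_\mathcal{C}$, then a complete set of eigenvectors of $\mathbf{M}_G$ can be constructed from the eigenvectors of the different $\mathbf{M}_{G_\mathcal{C}}$, where eigenvectors of $\mathbf{M}_{G_\mathcal{C}}$ are extended to have dimension $N$ via the addition of zero entries in all entries corresponding to nodes not in the currently considered component $\mathcal{C}$. (2) The mean $\mu(\mathbf{M}_G)$ and standard deviation $\sigma(\mathbf{M}_G)$ of the spectrum of $\mathbf{M}_G$ have the following analytic form: $$\mu(\mathbf{M}_G)=\frac1N\sum_{i=1}^N\frac{1}{v(i)},\qquad \sigma(\mathbf{M}_G)=\left[\left(\frac1N\sum_{(i,j)\in\mathcal{E}}\frac{1}{v(i)v(j)}\right)-\mu(\mathbf{M}_G)^2\right]^{1/2}.$$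
   Context: The edge set is $\mathcal{E}\subset\mathcal{V}\times\mathcal{V}$, a set of ordered pairs that is symmetric since $G$ is undirected; $a_{ij}=1$ if $(i,j)\in\mathcal{E}$ and $a_{ij}=0$ otherwise. The number $v(i)$ is a centrality metric associated with node $i$ (such as the node degree, $k$-core number, a PageRank-based score, or the count of walks of a specific length starting from $i$). The operator $\mathbf{M}_G$ (the Markov averaging operator) acts on functions $\varphi$ on $\mathcal{V}$ by $(\mathbf{M}_G\varphi)(i)=\frac{1}{v(i)}\sum_{j:(i,j)\in\mathcal{E}}\varphi(j)$. For a component $\mathcal{C}$, $\mathbf{M}_{G_\mathcal{C}}$ is the corresponding operator of the subgraph $G_\mathcal{C}$, i.e. the diagonal block of $\mathbf{M}_G$ indexed by $\mathcal{C}$. The spectrum of $\mathbf{M}_G$ is the collection of its $N$ eigenvalues counted with multiplicity; its mean is $\frac1N\sum_\lambda\lambda$ and its standard deviation is $\big(\frac1N\sum_\lambda(\lambda-\mu(\mathbf{M}_G))^2\big)^{1/2}$, sums being over the spectrum.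
   Formalization: The formula for the mean is stated only for graphs in which every node has a self-loop, (i,i) in E for all i; without this it fails (N=1, no edges, v=1: mean 0, formula 1). All other claims are for arbitrary symmetric E. *)

theory Defs
  imports
    "HOL-Computational_Algebra.Polynomial"
    "Jordan_Normal_Form.Char_Poly"
    "Jordan_Normal_Form.VS_Connect"
    "Jordan_Normal_Form.DL_Submatrix"
begin

text \<open>
  A graph is given by a finite vertex set \<open>W\<close> of natural numbers and a symmetric set \<open>E\<close> of
  ordered pairs; self-loops are allowed.  Matrix rows and columns are numbered from 0, and index
  \<open>i\<close> belongs to the vertex \<open>pick W i\<close>, the element of \<open>W\<close> having exactly \<open>i\<close> smaller ones
  (for \<open>W = {1..N}\<close> this is \<open>i + 1\<close>).
\<close>

definition adj_mat :: "nat set \<Rightarrow> (nat \<times> nat) set \<Rightarrow> real mat" where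
  "adj_mat W E = mat (card W) (card W)
     (\<lambda>(i, j). if (pick W i, pick W j) \<in> E then 1 else 0)"

text \<open>The diagonal factor is the inverse of \<open>diag(v)\<close> whenever \<open>v\<close> has no zero on \<open>W\<close>.\<close>

definition markov_mat :: "nat set \<Rightarrow> (nat \<times> nat) set \<Rightarrow> (nat \<Rightarrow> real) \<Rightarrow> real mat" where
  "markov_mat W E v = mat_diag (card W) (\<lambda>i. inverse (v (pick W i))) * adj_mat W E"

text \<open>\<open>Restr (E\<^sup>*) W\<close> is reachability inside \<open>W\<close> when \<open>E \<subseteq> W \<times> W\<close>, and an equivalence when \<open>E\<close> is symmetric.\<close>

definition conn_components :: "nat set \<Rightarrow> (nat \<times> nat) set \<Rightarrow> nat set set" where
  "conn_components W E = W // Restr (E\<^sup>*) W"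

definition component_mat :: "(nat \<times> nat) set \<Rightarrow> (nat \<Rightarrow> real) \<Rightarrow> nat set \<Rightarrow> real mat" where
  "component_mat E v C = markov_mat C (Restr E C) v"

text \<open>
  A vector indexed by the vertices of \<open>C\<close> is padded with zeros to one indexed by the vertices
  of \<open>W\<close>; the entry of a vertex \<open>a \<in> C\<close> sits at the position \<open>card {b \<in> C. b < a}\<close>.
\<close>

definition zero_extend :: "nat set \<Rightarrow> nat set \<Rightarrow> real vec \<Rightarrow> real vec" where
  "zero_extend W C x = vec (card W)
     (\<lambda>i. if pick W i \<in> C then x $ card {b \<in> C. b < pick W i} else 0)"

definition complete_eigenvectors :: "real mat \<Rightarrow> real vec set \<Rightarrow> bool" where
  "complete_eigenvectors A B \<longleftrightarrow>
     (\<forall>x\<in>B. \<exists>k. eigenvector A x k) \<and>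
     vectorspace.basis class_ring (module_vec TYPE(real) (dim_row A)) B"

text \<open>
  The eigenvalues counted with algebraic multiplicity.  Only real roots are collected, so these
  are all the eigenvalues exactly if \<open>size (eigval_mset A) = dim_row A\<close>.
\<close>

definition eigval_mset :: "real mat \<Rightarrow> real multiset" where
  "eigval_mset A = proots (char_poly A)"

definition spec_mean :: "real mat \<Rightarrow> real" where
  "spec_mean A = (\<Sum>k\<in>#eigval_mset A. k) / real (dim_row A)"

definition spec_sd :: "real mat \<Rightarrow> real" where
  "spec_sd A = sqrt ((\<Sum>k\<in>#eigval_mset A. (k - spec_mean A)\<^sup>2) / real (dim_row A))"

end

(* With D = diag(v), the matrix D^(-1) A is similar to the real symmetric matrix
   D^(-1/2) A D^(-1/2), so it is diagonalizable over the reals.  Hence the first two power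
   sums of the spectrum are the traces of M and M^2, and these yield the mean and the standard
   deviation.  No edge leaves a component, so zero extension maps eigenvectors of a block to
   eigenvectors of M; extensions from different components have disjoint supports and are
   therefore independent, and counting them gives N. *)

theory Submission
  imports Defs
begin

text \<open>Real diagonalizability is used twice: it gives \<open>eigval_mset\<close>, which
  collects real roots only, its full size \<open>N\<close>, and it supplies the eigenvector basis of
  each block, since a block is again the Markov matrix of a symmetric graph.

  The trace of M is the sum of 1/v(i) over the vertices that carry a self-loop. The closed form of
  the mean is therefore claimed when every vertex has a loop: a single loopless edge with v = 1 has
  spectrum 1, -1 and mean 0, whereas the formula would give 1. The trace of M^2 is the stated sum
  over edges in any case, so the standard deviation is expressed through the actual mean.

  Every vertex set is numbered from 0 in its own increasing order, so a vertex of \<open>C\<close>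
  has different positions in vectors over \<open>C\<close> and over \<open>W\<close>. Computations
  are moved from indices to vertices, and a position is recovered as the number of smaller
  vertices.\<close>

section \<open>Spectral theorem for real symmetric matrices\<close>

text \<open>The characteristic polynomial has a complex root; the Hermitian form of \<open>A\<close>
  at an eigenvector is real and forces that root to be real.\<close>

lemma real_symmetric_eigenvalue_exists:
  fixes A :: "real mat"
  assumes A: "A \<in> carrier_mat n n" and sym: "transpose_mat A = A" and n: "n \<noteq> 0"
  shows "\<exists>e. eigenvalue A e"
proof -
  define B where "B = map_mat complex_of_real A"
  have B: "B \<in> carrier_mat n n" using A by (simp add: B_def)
  have "degree (char_poly B) = n" using degree_monic_char_poly[OF B] by simp
  then have "\<not> constant (poly (char_poly B))" using n by (simp add: constant_degree)
  then obtain z where z: "poly (char_poly B) z = 0"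
    using fundamental_theorem_of_algebra by blast
  then obtain x where x: "x \<in> carrier_vec n" "x \<noteq> 0\<^sub>v n" "B *\<^sub>v x = z \<cdot>\<^sub>v x"
    using B eigenvalue_root_char_poly[OF B, of z] by (auto simp: eigenvalue_def eigenvector_def)
  have Asym: "A $$ (i, j) = A $$ (j, i)" if "i < n" "j < n" for i j
    using arg_cong[OF sym, of "\<lambda>M. M $$ (i, j)"] that A by simp
  \<comment> \<open>The Hermitian form of \<open>A\<close> at \<open>x\<close>. The eigenvector
    equation gives \<open>z * of_real s\<close>, while conjugating and swapping the sums returns
    \<open>q\<close> itself.\<close>
  define q where "q = (\<Sum>i<n. \<Sum>j<n. complex_of_real (A $$ (i, j)) * x $ j * cnj (x $ i))"
  have row: "(\<Sum>j<n. complex_of_real (A $$ (i, j)) * x $ j) = z * x $ i" if "i < n" for i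
  proof -
    have "(B *\<^sub>v x) $ i = (\<Sum>j<n. complex_of_real (A $$ (i, j)) * x $ j)"
      using that A x(1) by (simp add: B_def scalar_prod_def atLeast0LessThan)
    then show ?thesis using x that by simp
  qed
  define s where "s = (\<Sum>i<n. (cmod (x $ i))\<^sup>2)"
  have "q = (\<Sum>i<n. (\<Sum>j<n. complex_of_real (A $$ (i, j)) * x $ j) * cnj (x $ i))"
    by (simp add: q_def sum_distrib_right)
  also have "\<dots> = (\<Sum>i<n. z * of_real ((cmod (x $ i))\<^sup>2))"
    by (intro sum.cong refl) (simp add: row mult.assoc complex_norm_square del: of_real_power)
  finally have q: "q = z * of_real s" by (simp add: s_def sum_distrib_left)
  have "cnj q = (\<Sum>i<n. \<Sum>j<n. complex_of_real (A $$ (i, j)) * cnj (x $ j) * x $ i)"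
    by (simp add: q_def)
  also have "\<dots> = (\<Sum>j<n. \<Sum>i<n. complex_of_real (A $$ (i, j)) * cnj (x $ j) * x $ i)"
    by (rule sum.swap)
  also have "\<dots> = q" unfolding q_def
    by (intro sum.cong refl) (simp add: Asym mult_ac)
  finally have "cnj z * of_real s = z * of_real s" by (simp add: q)
  moreover have "s \<noteq> 0"
  proof
    assume "s = 0"
    then have "\<forall>i<n. x $ i = 0" by (simp add: s_def sum_nonneg_eq_0_iff)
    then have "x = 0\<^sub>v n" using x(1) by (intro eq_vecI) auto
    with x(2) show False ..
  qed
  ultimately have "cnj z = z" by simp
  then have zr: "z = of_real (Re z)" by (simp add: complex_eq_iff)
  \<comment> \<open>With \<open>z\<close> real, the real characteristic polynomial vanishes at
    \<open>Re z\<close>, so no real vector has to be extracted from \<open>x\<close>.\<close>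
  have "char_poly B = map_poly of_real (char_poly A)"
    unfolding B_def by (rule of_real_hom.char_poly_hom[OF A])
  then have "of_real (poly (char_poly A) (Re z)) = poly (char_poly B) (of_real (Re z))"
    by simp
  then have "poly (char_poly A) (Re z) = 0" using z zr by simp
  then show ?thesis using eigenvalue_root_char_poly[OF A] by blast
qed

text \<open>The reflection in the hyperplane orthogonal to \<open>w\<close>, the difference of the
  first unit vector and \<open>u\<close>, exchanges these two vectors. Since \<open>u\<close> has
  length 1, |w|^2 = 2 (1 - u $ 0), so \<open>c\<close> is the usual factor 2 / |w|^2. Being
  symmetric and involutive, \<open>H\<close> is its own inverse and transpose.\<close>

lemma householder_reflection:
  fixes u :: "real vec"
  assumes u: "u \<in> carrier_vec n" "u \<bullet> u = 1" and n: "n \<noteq> 0"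
  obtains H where "H \<in> carrier_mat n n" "transpose_mat H = H" "H * H = 1\<^sub>m n"
    "H *\<^sub>v unit_vec n 0 = u"
proof -
  define w where "w i = (if i = 0 then 1 else 0) - u $ i" for i
  \<comment> \<open>If \<open>u\<close> is already the first unit vector, then \<open>c = 1 / 0 = 0\<close> and \<open>H\<close> is the identity.\<close>
  define c where "c = 1 / (1 - u $ 0)"
  define H where "H = mat n n (\<lambda>(i, j). (if i = j then 1 else 0) - c * w i * w j)"
  have uu: "(\<Sum>i<n. (u $ i)\<^sup>2) = 1"
    using u by (simp add: scalar_prod_def atLeast0LessThan power2_eq_square)
  have "(\<Sum>i<n. (w i)\<^sup>2) = (\<Sum>i<n. (if i = 0 then 1 - 2 * u $ 0 else 0) + (u $ i)\<^sup>2)"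
    by (intro sum.cong refl) (simp add: w_def power2_eq_square algebra_simps)
  also have "\<dots> = 2 * (1 - u $ 0)" using n uu by (simp add: sum.distrib)
  finally have ww: "(\<Sum>i<n. (w i)\<^sup>2) = 2 * (1 - u $ 0)" .
  \<comment> \<open>True also in the degenerate case \<open>c = 0\<close>. With the value of |w|^2
    it makes the quadratic term of \<open>H * H\<close> cancel the two linear ones.\<close>
  have "c * (1 - u $ 0) * c = c" by (cases "u $ 0 = 1") (simp_all add: c_def)
  moreover have "c * c * (\<Sum>i<n. (w i)\<^sup>2) = 2 * (c * (1 - u $ 0) * c)"
    by (simp add: ww algebra_simps)
  ultimately have cc: "c * c * (\<Sum>i<n. (w i)\<^sup>2) = 2 * c" by (simp only:)
  \<comment> \<open>Normally \<open>c * w 0 = 1\<close>; in the degenerate case \<open>w\<close> has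
    length 0 and both sides vanish.\<close>
  have w0: "c * w i * w 0 = w i" if "i < n" for i
  proof (cases "u $ 0 = 1")
    case True
    then have "(\<Sum>i<n. (w i)\<^sup>2) = 0" by (simp add: ww)
    then have "w i = 0" using that by (simp add: sum_nonneg_eq_0_iff)
    then show ?thesis by simp
  next
    case False
    then show ?thesis by (simp add: c_def w_def[of 0])
  qed
  show thesis
  proof
    show "H \<in> carrier_mat n n" by (simp add: H_def)
    show "transpose_mat H = H" by (rule eq_matI) (auto simp: H_def)
    show "H * H = 1\<^sub>m n"
    proof (rule eq_matI)
      fix i j assume "i < dim_row (1\<^sub>m n :: real mat)" "j < dim_col (1\<^sub>m n :: real mat)"
      then have ij: "i < n" "j < n" by auto
      have "(H * H) $$ (i, j) = (\<Sum>k<n. ((if i = k then 1 else 0) - c * w i * w k) *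
          ((if k = j then 1 else 0) - c * w k * w j))"
        using ij by (simp add: H_def scalar_prod_def atLeast0LessThan)
      also have "\<dots> = (\<Sum>k<n. (if k = i then if i = j then 1 else 0 else 0)
          - (if k = i then c * w i * w j else 0) - (if k = j then c * w i * w j else 0)
          + c * c * (w k)\<^sup>2 * (w i * w j))"
        by (intro sum.cong refl) (simp add: power2_eq_square algebra_simps)
      also have "\<dots> = (if i = j then 1 else 0) - c * w i * w j - c * w i * w j
          + c * c * (\<Sum>k<n. (w k)\<^sup>2) * (w i * w j)"
        using ij by (simp add: sum.distrib sum_subtractf sum_distrib_left sum_distrib_right)
      also have "\<dots> = (if i = j then 1 else 0)" by (simp add: cc)
      finally show "(H * H) $$ (i, j) = 1\<^sub>m n $$ (i, j)" using ij by simp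
    qed (auto simp: H_def)
    show "H *\<^sub>v unit_vec n 0 = u"
    proof (rule eq_vecI)
      fix i assume "i < dim_vec u"
      then have i: "i < n" using u by simp
      have "(H *\<^sub>v unit_vec n 0) $ i = H $$ (i, 0)" using i n by (simp add: H_def)
      also have "\<dots> = (if i = 0 then 1 else 0) - w i" using i n w0[OF i] by (simp add: H_def)
      also have "\<dots> = u $ i" by (simp add: w_def)
      finally show "(H *\<^sub>v unit_vec n 0) $ i = u $ i" .
    qed (use u in \<open>simp add: H_def\<close>)
  qed
qed


text \<open>Induction on the dimension: a Householder matrix takes a unit eigenvector to the first
  unit vector, symmetry clears the first row along with the first column, and the induction
  hypothesis handles the remaining block.\<close>

lemma real_symmetric_diagonalization:
  fixes A :: "real mat"
  assumes "A \<in> carrier_mat n n" and "transpose_mat A = A"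
  shows "\<exists>P d. P \<in> carrier_mat n n \<and> transpose_mat P * P = 1\<^sub>m n \<and>
    A = P * mat_diag n d * transpose_mat P"
  using assms
proof (induction n arbitrary: A)
  case 0
  then show ?case by (intro exI[of _ "1\<^sub>m 0"] exI[of _ "\<lambda>_. 0"]) auto
next
  case (Suc m)
  let ?n = "Suc m"
  note A = Suc.prems(1) and sym = Suc.prems(2)
  obtain e x where x: "x \<in> carrier_vec ?n" "x \<noteq> 0\<^sub>v ?n" "A *\<^sub>v x = e \<cdot>\<^sub>v x"
    using real_symmetric_eigenvalue_exists[OF A sym] A
    by (auto simp: eigenvalue_def eigenvector_def)
  define u where "u = (1 / sqrt (x \<bullet> x)) \<cdot>\<^sub>v x"
  have "x \<bullet> x > 0" using conjugate_square_greater_0_vec[OF x(1)] x(2) by simp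
  then have uu: "u \<bullet> u = 1" using x(1) by (simp add: u_def field_simps)
  have u: "u \<in> carrier_vec ?n" using x(1) by (simp add: u_def)
  have Au: "A *\<^sub>v u = e \<cdot>\<^sub>v u"
    using x A by (simp add: u_def mult_mat_vec smult_smult_assoc mult.commute)
  obtain H where H: "H \<in> carrier_mat ?n ?n" "transpose_mat H = H" "H * H = 1\<^sub>m ?n"
    and Hu: "H *\<^sub>v unit_vec ?n 0 = u"
    using householder_reflection[OF u uu] by auto
  \<comment> \<open>Deflation: the first column of the symmetric matrix \<open>H * A * H\<close> is \<open>e\<close> times the first unit vector.\<close>
  define B where "B = H * A * H"
  have B: "B \<in> carrier_mat ?n ?n" using A H by (simp add: B_def)
  have Bsym: "transpose_mat B = B"
    using A H sym by (simp add: B_def transpose_mult[of _ ?n ?n _ ?n] assoc_mult_mat[of _ ?n ?n _ ?n _ ?n])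
  have "H *\<^sub>v u = (H * H) *\<^sub>v unit_vec ?n 0"
    using H(1) by (simp add: Hu)
  then have Hu': "H *\<^sub>v u = unit_vec ?n 0" using H(3) by simp
  have "B *\<^sub>v unit_vec ?n 0 = e \<cdot>\<^sub>v unit_vec ?n 0"
  proof -
    have "B *\<^sub>v unit_vec ?n 0 = H *\<^sub>v (A *\<^sub>v (H *\<^sub>v unit_vec ?n 0))"
      unfolding B_def
      by (subst assoc_mult_mat_vec[of _ ?n ?n], use A H in auto)+
    then show ?thesis using H(1) u by (simp add: Hu Au mult_mat_vec Hu')
  qed
  note Bu = this
  have col0: "B $$ (i, 0) = (if i = 0 then e else 0)" if "i < ?n" for i
  proof -
    have "B $$ (i, 0) = (B *\<^sub>v unit_vec ?n 0) $ i" using B that by simp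
    then show ?thesis using that by (simp add: Bu)
  qed
  have Bswap: "B $$ (i, j) = B $$ (j, i)" if "i < ?n" "j < ?n" for i j
    using arg_cong[OF Bsym, of "\<lambda>M. M $$ (i, j)"] that B by simp
  define C where "C = mat m m (\<lambda>(i, j). B $$ (Suc i, Suc j))"
  have C: "C \<in> carrier_mat m m" "transpose_mat C = C"
    by (auto simp: C_def Bswap intro!: eq_matI)
  obtain Q d where Q: "Q \<in> carrier_mat m m" "transpose_mat Q * Q = 1\<^sub>m m"
    and CQ: "C = Q * mat_diag m d * transpose_mat Q"
    using Suc.IH[OF C] by blast
  define R where "R = four_block_mat (1\<^sub>m 1) (0\<^sub>m 1 m) (0\<^sub>m m 1) Q"
  define d' where "d' i = (case i of 0 \<Rightarrow> e | Suc j \<Rightarrow> d j)" for i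
  have R: "R \<in> carrier_mat ?n ?n" using Q four_block_carrier_mat[of "1\<^sub>m 1" 1 1 Q m m] by (simp add: R_def)
  have Rt: "transpose_mat R = four_block_mat (1\<^sub>m 1) (0\<^sub>m 1 m) (0\<^sub>m m 1) (transpose_mat Q)"
    unfolding R_def using Q by (subst transpose_four_block_mat[of _ 1 1 _ m _ m]) auto
  have D: "mat_diag ?n d' = four_block_mat (e \<cdot>\<^sub>m 1\<^sub>m 1) (0\<^sub>m 1 m) (0\<^sub>m m 1) (mat_diag m d)"
    by (rule eq_matI) (auto simp: mat_diag_def d'_def split: nat.splits)
  have RR: "transpose_mat R * R = 1\<^sub>m ?n"
    unfolding Rt unfolding R_def
    using Q by (subst mult_four_block_mat[of _ 1 1 _ m _ m _ _ 1 _ m]) (auto simp: four_block_one_mat)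
  have B_block: "B = four_block_mat (e \<cdot>\<^sub>m 1\<^sub>m 1) (0\<^sub>m 1 m) (0\<^sub>m m 1) C"
  proof (rule eq_matI)
    fix i j assume "i < dim_row (four_block_mat (e \<cdot>\<^sub>m 1\<^sub>m 1) (0\<^sub>m 1 m) (0\<^sub>m m 1) C)"
      "j < dim_col (four_block_mat (e \<cdot>\<^sub>m 1\<^sub>m 1) (0\<^sub>m 1 m) (0\<^sub>m m 1) C)"
    then have "i < ?n" "j < ?n" using C by auto
    then show "B $$ (i, j) = four_block_mat (e \<cdot>\<^sub>m 1\<^sub>m 1) (0\<^sub>m 1 m) (0\<^sub>m m 1) C $$ (i, j)"
      using col0[of i] col0[of j] Bswap[of i j] by (auto simp: C_def)
  qed (use B C in auto)
  have BR: "B = R * mat_diag ?n d' * transpose_mat R"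
  proof -
    define G where "G = Q * mat_diag m d"
    have G: "G \<in> carrier_mat m m" using Q by (simp add: G_def)
    have "R * mat_diag ?n d' = four_block_mat (e \<cdot>\<^sub>m 1\<^sub>m 1) (0\<^sub>m 1 m) (0\<^sub>m m 1) G"
      unfolding D R_def G_def
      using Q left_mult_zero_mat[OF mat_diag_dim[of m d], of 1]
      by (subst mult_four_block_mat[of _ 1 1 _ m _ m _ _ 1 _ m]) auto
    also have "\<dots> * transpose_mat R = B"
      unfolding Rt B_block CQ G_def[symmetric]
      using Q G by (subst mult_four_block_mat[of _ 1 1 _ m _ m _ _ 1 _ m]) auto
    finally show ?thesis by simp
  qed
  have "A = (H * H) * A * (H * H)" using A H by simp
  also have "\<dots> = H * B * H" using A H(1)
    by (simp add: B_def assoc_mult_mat[of _ ?n ?n _ ?n _ ?n])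
  also have "\<dots> = (H * R) * mat_diag ?n d' * transpose_mat (H * R)"
  proof -
    have "H * (R * X * Y) * H = (H * R) * X * (Y * H)"
      if "X \<in> carrier_mat ?n ?n" "Y \<in> carrier_mat ?n ?n" for X Y
      using H(1) R that by (simp add: assoc_mult_mat[of _ ?n ?n _ ?n _ ?n])
    then show ?thesis
      using H(1,2) R by (simp add: BR transpose_mult[of _ ?n ?n _ ?n] del: assoc_mult_mat)
  qed
  finally have "A = (H * R) * mat_diag ?n d' * transpose_mat (H * R)" .
  moreover have "transpose_mat (H * R) * (H * R) = transpose_mat R * ((H * H) * R)"
    using H(1,2) R by (simp add: assoc_mult_mat[of _ ?n ?n _ ?n _ ?n] transpose_mult[of _ ?n ?n _ ?n])
  then have "transpose_mat (H * R) * (H * R) = 1\<^sub>m ?n" using H(3) R RR by simp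
  ultimately show ?case using H(1) R by (intro exI[of _ "H * R"] exI[of _ d']) auto
qed

section \<open>Traces and power sums of the spectrum\<close>

definition mtrace :: "'a :: comm_monoid_add mat \<Rightarrow> 'a" where
  "mtrace A = (\<Sum>i<dim_row A. A $$ (i, i))"

lemma mtrace_mult_comm:
  fixes A :: "'a :: comm_semiring_0 mat"
  assumes "A \<in> carrier_mat n m" "B \<in> carrier_mat m n"
  shows "mtrace (A * B) = mtrace (B * A)"
proof -
  have "mtrace (A * B) = (\<Sum>i<n. \<Sum>j<m. A $$ (i, j) * B $$ (j, i))"
    using assms by (simp add: mtrace_def scalar_prod_def atLeast0LessThan)
  also have "\<dots> = (\<Sum>j<m. \<Sum>i<n. A $$ (i, j) * B $$ (j, i))" by (rule sum.swap)
  also have "\<dots> = mtrace (B * A)"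
    using assms by (simp add: mtrace_def scalar_prod_def atLeast0LessThan mult.commute)
  finally show ?thesis .
qed

lemma mtrace_similar:
  fixes A :: "'a :: comm_semiring_1 mat"
  assumes "similar_mat_wit A B P Q"
  shows "mtrace A = mtrace B"
proof -
  define n where "n = dim_row A"
  note * = similar_mat_witD[OF n_def assms]
  have "mtrace A = mtrace (Q * (P * B))"
    unfolding *(3) by (rule mtrace_mult_comm[of _ n n]) (use * in auto)
  also have "Q * (P * B) = (Q * P) * B" using *(5-7) by (simp add: assoc_mult_mat[of Q n n P n B n])
  finally show ?thesis using * by simp
qed

text \<open>Similar matrices share the characteristic polynomial, and that of a diagonal matrix is a
  product of linear factors, whose roots are the diagonal entries with multiplicity.\<close>

lemma eigval_mset_similar_diag:
  assumes "similar_mat_wit A (mat_diag n d) P Q" "A \<in> carrier_mat n n"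
  shows "eigval_mset A = image_mset d (mset [0..<n])"
proof -
  have "char_poly A = char_poly (mat_diag n d)"
    using assms by (intro char_poly_similar) (auto simp: similar_mat_def)
  also have "\<dots> = (\<Prod>a\<leftarrow>diag_mat (mat_diag n d). [:- a, 1:])"
    by (rule char_poly_upper_triangular[of _ n]) (auto simp: mat_diag_def)
  also have "diag_mat (mat_diag n d) = map d [0..<n]"
    by (auto simp: diag_mat_def mat_diag_def)
  finally have "eigval_mset A = proots (\<Prod>k\<leftarrow>[0..<n]. [:- d k, 1:])"
    by (simp add: eigval_mset_def o_def)
  also have "\<dots> = image_mset d (mset [0..<n])"
  proof (induction n)
    case (Suc n)
    \<comment> \<open>The root multisets of two factors add up only if their product is
      nonzero.\<close>
    have "(\<Prod>k\<leftarrow>[0..<n]. [:- d k, 1:]) \<noteq> 0" by (auto simp: prod_list_zero_iff)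
    then show ?case using Suc by (simp add: proots_mult del: mult_pCons_right)
  qed simp
  finally show ?thesis .
qed

text \<open>The trace is invariant under similarity, so both sides equal power sums of
  \<open>d\<close>. The size certifies that no eigenvalue is missed by collecting real
  roots.\<close>

lemma eigval_mset_power_sums:
  assumes "similar_mat_wit A (mat_diag n d) P Q" "A \<in> carrier_mat n n"
  shows "size (eigval_mset A) = n"
    and "sum_mset (eigval_mset A) = mtrace A"
    and "(\<Sum>k\<in>#eigval_mset A. k\<^sup>2) = mtrace (A * A)"
proof -
  note eig = eigval_mset_similar_diag[OF assms]
  show "size (eigval_mset A) = n" by (simp add: eig)
  have "mtrace (mat_diag n f) = (\<Sum>i<n. f i)" for f :: "nat \<Rightarrow> real"
    by (simp add: mtrace_def mat_diag_def)
  note tr = this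
  have "mtrace A = (\<Sum>i<n. d i)" using mtrace_similar[OF assms(1)] by (simp add: tr)
  then show "sum_mset (eigval_mset A) = mtrace A"
    by (simp add: eig sum_unfold_sum_mset atLeast0LessThan)
  have "similar_mat_wit (A * A) (mat_diag n d * mat_diag n d) P Q"
    using similar_mat_wit_pow[OF assms(1), of 2] assms(2)
    by (simp add: numeral_2_eq_2)
  from mtrace_similar[OF this] have "mtrace (A * A) = (\<Sum>i<n. (d i)\<^sup>2)"
    by (simp add: tr power2_eq_square)
  then show "(\<Sum>k\<in>#eigval_mset A. k\<^sup>2) = mtrace (A * A)"
    by (simp add: eig sum_unfold_sum_mset atLeast0LessThan image_mset.compositionality o_def)
qed

section \<open>Eigenvector bases from a diagonal form\<close>

lemma basis_if_lin_indpt_card: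
  assumes "S \<subseteq> carrier_vec n" "card S = n" "finite S"
    and "\<not> module.lin_dep class_ring (module_vec TYPE('a :: field) n) S"
  shows "vectorspace.basis class_ring (module_vec TYPE('a) n) S"
proof -
  interpret vec_space "TYPE('a)" n .
  show ?thesis using assms dim_is_n by (intro dim_li_is_basis) auto
qed

text \<open>Read column by column, \<open>A * P = P * mat_diag n d\<close> says that column
  \<open>i\<close> of \<open>P\<close> is an eigenvector for \<open>d i\<close>; invertibility of
  \<open>P\<close> makes the columns a basis.\<close>

lemma complete_eigenvectors_similar_diag:
  assumes "similar_mat_wit A (mat_diag n d) P Q" "A \<in> carrier_mat n n"
  shows "complete_eigenvectors A (set (cols P))"
proof -
  interpret vec_space "TYPE(real)" n .
  note * = similar_mat_witD2[OF assms(2,1)]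
  have det: "det P \<noteq> 0"
    using det_mult[OF *(6,7)] *(1) by auto
  have AP: "A * P = P * mat_diag n d"
  proof -
    have "A * P = P * mat_diag n d * (Q * P)"
      unfolding *(3) by (rule assoc_mult_mat[of _ n n _ n _ n]) (use * in auto)
    then show ?thesis using * by simp
  qed
  have col: "A *\<^sub>v col P i = d i \<cdot>\<^sub>v col P i" if i: "i < n" for i
  proof -
    have "A *\<^sub>v col P i = col (A * P) i" using col_mult2[OF assms(2) *(6) i] by simp
    also have "\<dots> = d i \<cdot>\<^sub>v col P i"
      unfolding AP using i *(6) by (subst mat_diag_mult_right[of _ n]) (auto intro!: eq_vecI)
    finally show ?thesis .
  qed
  have ind: "\<not> lin_dep (set (cols P))"
    using det idom_vec.lin_dep_cols_imp_det_0[OF *(6)] by blast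
  \<comment> \<open>\<open>set\<close> forgets repetitions, so the count \<open>n\<close> needs
    distinct columns; two equal ones would make the determinant zero.\<close>
  have dist: "distinct (cols P)"
    using det det_identical_columns[OF *(6)] *(6) by (force simp: distinct_conv_nth)
  have "card (set (cols P)) = n" using distinct_card[OF dist] *(6) by simp
  then have "basis (set (cols P))"
    using ind *(6) cols_dim[of P] by (intro basis_if_lin_indpt_card) auto
  moreover have "\<exists>k. eigenvector A x k" if "x \<in> set (cols P)" for x
  proof -
    obtain i where "i < length (cols P)" "cols P ! i = x"
      using \<open>x \<in> set (cols P)\<close> by (auto simp: in_set_conv_nth)
    then have i: "i < n" "x = col P i" using *(6) by auto
    have "x \<noteq> 0\<^sub>v n"
    proof
      assume "x = 0\<^sub>v n"
      then show False using vs_zero_lin_dep[of "set (cols P)"] ind that *(6) cols_dim[of P] by auto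
    qed
    then show ?thesis using i col[OF i(1)] assms(2) *(6) by (auto simp: eigenvector_def)
  qed
  ultimately show ?thesis using assms(2) by (auto simp: complete_eigenvectors_def)
qed

section \<open>Vertex numbering and the Markov matrix\<close>

lemma rank_less_card:
  fixes W :: "nat set"
  assumes "finite W" "a \<in> W"
  shows "card {b \<in> W. b < a} < card W"
  using assms by (intro psubset_card_mono) auto

lemma bij_betw_pick:
  assumes "finite W"
  shows "bij_betw (pick W) {..<card W} W"
  by (rule bij_betw_byWitness[where f' = "\<lambda>a. card {b \<in> W. b < a}"])
     (use assms in \<open>auto simp: pick_in_set card_pick pick_card_in_set rank_less_card\<close>)

text \<open>Passes from indices to vertices. \<open>f\<close> takes both, because edges are tested
  on vertices while vector entries are read at indices.\<close>

lemma sum_pick: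
  assumes "finite W"
  shows "(\<Sum>j<card W. f (pick W j) j) = (\<Sum>b\<in>W. f b (card {c \<in> W. c < b}))"
  by (rule sum.reindex_bij_betw[OF bij_betw_pick[OF assms], symmetric, THEN trans, symmetric])
     (auto intro!: sum.cong simp: card_pick)

lemma markov_mat_carrier [simp]: "markov_mat W E v \<in> carrier_mat (card W) (card W)"
  by (simp add: markov_mat_def adj_mat_def mat_diag_mult_left[of _ _ "card W"])

lemma markov_mat_dims [simp]:
  "dim_row (markov_mat W E v) = card W" "dim_col (markov_mat W E v) = card W"
  using markov_mat_carrier[of W E v] by (simp_all del: markov_mat_carrier)

lemma markov_mat_index:
  assumes "i < card W" "j < card W"
  shows "markov_mat W E v $$ (i, j) = (if (pick W i, pick W j) \<in> E then 1 / v (pick W i) else 0)"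
  using assms
  by (simp add: markov_mat_def adj_mat_def mat_diag_mult_left[of _ _ "card W"] field_simps)

lemma markov_mat_mult_vec_index:
  assumes "finite W" "x \<in> carrier_vec (card W)" "i < card W"
  shows "(markov_mat W E v *\<^sub>v x) $ i =
    (\<Sum>b\<in>W. if (pick W i, b) \<in> E then x $ card {c \<in> W. c < b} / v (pick W i) else 0)"
proof -
  have "(markov_mat W E v *\<^sub>v x) $ i = (\<Sum>j<card W. markov_mat W E v $$ (i, j) * x $ j)"
    using assms markov_mat_carrier[of W E v]
    by (simp add: scalar_prod_def atLeast0LessThan del: markov_mat_carrier)
  also have "\<dots> = (\<Sum>j<card W. if (pick W i, pick W j) \<in> E then x $ j / v (pick W i) else 0)"
    using assms by (intro sum.cong) (auto simp: markov_mat_index)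
  finally show ?thesis
    by (simp add: sum_pick[OF assms(1), of "\<lambda>b j. if (pick W i, b) \<in> E then x $ j / v (pick W i) else 0"])
qed

text \<open>Conjugation by the square roots \<open>r\<close> splits the row factor 1/v evenly
  between row and column, which leaves the symmetric \<open>S\<close>; positivity of
  \<open>v\<close> makes \<open>r\<close> real and invertible.\<close>

lemma markov_mat_similar_diag:
  assumes W: "finite W" and E: "sym E" and v: "\<And>a. a \<in> W \<Longrightarrow> 0 < v a"
  shows "\<exists>d P Q. similar_mat_wit (markov_mat W E v) (mat_diag (card W) d) P Q"
proof -
  let ?n = "card W"
  define r where "r i = sqrt (v (pick W i))" for i
  have r: "r i > 0" "v (pick W i) = r i * r i" if "i < ?n" for i
    using v[of "pick W i"] that by (auto simp: r_def pick_in_set)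
  define S where "S = mat ?n ?n (\<lambda>(i, j). if (pick W i, pick W j) \<in> E then 1 / (r i * r j) else 0)"
  have S: "S \<in> carrier_mat ?n ?n" "transpose_mat S = S"
    using symD[OF E] by (auto simp: S_def mult.commute intro!: eq_matI)
  have MS: "similar_mat_wit (markov_mat W E v) S (mat_diag ?n (\<lambda>i. 1 / r i)) (mat_diag ?n r)"
  proof (rule similar_mat_witI)
    have "mat_diag ?n (\<lambda>i. 1 / r i * r i) = 1\<^sub>m ?n" "mat_diag ?n (\<lambda>i. r i * (1 / r i)) = 1\<^sub>m ?n"
      using r(1) by (auto simp: mat_diag_def less_imp_neq[THEN not_sym] intro!: eq_matI)
    then show "mat_diag ?n (\<lambda>i. 1 / r i) * mat_diag ?n r = 1\<^sub>m ?n"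
      "mat_diag ?n r * mat_diag ?n (\<lambda>i. 1 / r i) = 1\<^sub>m ?n" by simp_all
    show "markov_mat W E v = mat_diag ?n (\<lambda>i. 1 / r i) * S * mat_diag ?n r"
      using S(1) markov_mat_carrier[of W E v] r
      by (intro eq_matI) (auto simp: mat_diag_mult_left[of _ _ ?n] mat_diag_mult_right[of _ ?n]
          markov_mat_index S_def less_imp_neq[THEN not_sym])
  qed (use S in auto)
  obtain P d where P: "P \<in> carrier_mat ?n ?n" "transpose_mat P * P = 1\<^sub>m ?n"
    "S = P * mat_diag ?n d * transpose_mat P"
    using real_symmetric_diagonalization[OF S] by blast
  have "P * transpose_mat P = 1\<^sub>m ?n"
    using mat_mult_left_right_inverse[OF _ P(1,2)] P(1) by simp
  then have "similar_mat_wit S (mat_diag ?n d) P (transpose_mat P)"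
    using P S by (intro similar_mat_witI) auto
  from similar_mat_wit_trans[OF MS this] show ?thesis by blast
qed

section \<open>Zero extension of block vectors\<close>

lemma zero_extend_carrier [simp]: "zero_extend W C x \<in> carrier_vec (card W)"
  by (simp add: zero_extend_def)

lemma zero_extend_index:
  assumes "finite W" "a \<in> W"
  shows "zero_extend W C x $ card {b \<in> W. b < a} = (if a \<in> C then x $ card {b \<in> C. b < a} else 0)"
  using assms by (simp add: zero_extend_def rank_less_card pick_card_in_set)

text \<open>Entry \<open>i\<close> of \<open>x\<close> survives at the position of
  \<open>pick C i\<close> in \<open>W\<close>. This keeps padded eigenvectors nonzero and lets
  padded bases be counted.\<close>

lemma zero_extend_inj:
  assumes "finite W" "C \<subseteq> W" "x \<in> carrier_vec (card C)" "y \<in> carrier_vec (card C)"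
    and "zero_extend W C x = zero_extend W C y"
  shows "x = y"
proof (rule eq_vecI)
  fix i assume "i < dim_vec y"
  then have i: "i < card C" using assms by simp
  then have "pick C i \<in> C" by (simp add: pick_in_set)
  then show "x $ i = y $ i"
    using arg_cong[OF assms(5), of "\<lambda>z. z $ card {b \<in> W. b < pick C i}"] assms(1,2) i
    by (auto simp: zero_extend_index card_pick)
qed (use assms in simp)

lemma zero_extend_0:
  assumes "finite W" "C \<subseteq> W"
  shows "zero_extend W C (0\<^sub>v (card C)) = 0\<^sub>v (card W)"
  using assms finite_subset[OF assms(2,1)]
  by (intro eq_vecI) (auto simp: zero_extend_def rank_less_card)

text \<open>At a vertex of \<open>C\<close> the padding cuts the neighbour sum down to
  \<open>C\<close>, as in the block. A vertex outside \<open>C\<close> has no neighbour in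
  \<open>C\<close> by \<open>closed\<close>, so its sum is 0, like its padded entry.\<close>

lemma eigenvector_zero_extend:
  assumes W: "finite W" and C: "C \<subseteq> W"
    and closed: "\<And>a b. (a, b) \<in> E \<Longrightarrow> a \<in> W \<Longrightarrow> b \<in> C \<Longrightarrow> a \<in> C"
    and ev: "eigenvector (component_mat E v C) x k"
  shows "eigenvector (markov_mat W E v) (zero_extend W C x) k"
proof -
  have fC: "finite C" using W C by (rule finite_subset[rotated])
  have Md: "dim_row (markov_mat W E v) = card W" "dim_row (component_mat E v C) = card C"
    using markov_mat_carrier unfolding component_mat_def by blast+
  have x: "x \<in> carrier_vec (card C)" "x \<noteq> 0\<^sub>v (card C)" "component_mat E v C *\<^sub>v x = k \<cdot>\<^sub>v x"
    using ev by (auto simp: eigenvector_def Md)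
  have "markov_mat W E v *\<^sub>v zero_extend W C x = k \<cdot>\<^sub>v zero_extend W C x"
  proof (rule eq_vecI)
    fix i assume "i < dim_vec (k \<cdot>\<^sub>v zero_extend W C x)"
    then have i: "i < card W" by (simp add: zero_extend_def)
    define a where "a = pick W i"
    have a: "a \<in> W" and ia: "i = card {b \<in> W. b < a}"
      using i by (auto simp: a_def pick_in_set card_pick)
    have "(markov_mat W E v *\<^sub>v zero_extend W C x) $ i =
        (\<Sum>b\<in>W. if (a, b) \<in> E \<and> b \<in> C then x $ card {c \<in> C. c < b} / v a else 0)"
      using W i
      by (subst markov_mat_mult_vec_index) (auto simp: a_def zero_extend_index intro!: sum.cong)
    also have "\<dots> = (\<Sum>b\<in>C. if (a, b) \<in> E then x $ card {c \<in> C. c < b} / v a else 0)"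
      using W C by (intro sum.mono_neutral_cong_right) auto
    also have "\<dots> = (if a \<in> C then (component_mat E v C *\<^sub>v x) $ card {b \<in> C. b < a} else 0)"
    proof (cases "a \<in> C")
      case True
      then show ?thesis
        unfolding component_mat_def using fC x(1)
        by (subst markov_mat_mult_vec_index) (auto simp: rank_less_card pick_card_in_set intro!: sum.cong)
    next
      case False
      then show ?thesis using closed a by (auto intro!: sum.neutral)
    qed
    also have "\<dots> = (k \<cdot>\<^sub>v zero_extend W C x) $ i"
      using x fC i W a zero_extend_carrier[of W C x]
      by (auto simp: ia zero_extend_index rank_less_card simp del: zero_extend_carrier)
    finally show "(markov_mat W E v *\<^sub>v zero_extend W C x) $ i = (k \<cdot>\<^sub>v zero_extend W C x) $ i" .
  qed (simp add: Md zero_extend_def)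
  moreover have "zero_extend W C x \<noteq> 0\<^sub>v (card W)"
    using zero_extend_inj[OF W C x(1) zero_carrier_vec] zero_extend_0[OF W C] x(2) by metis
  ultimately show ?thesis by (simp add: eigenvector_def Md)
qed

section \<open>Traces of the Markov matrix and of its square\<close>

lemma mtrace_markov_mat:
  assumes "finite W" "\<And>a. a \<in> W \<Longrightarrow> (a, a) \<in> E"
  shows "mtrace (markov_mat W E v) = (\<Sum>a\<in>W. 1 / v a)"
proof -
  have "mtrace (markov_mat W E v) = (\<Sum>i<card W. 1 / v (pick W i))"
    using assms(2) markov_mat_carrier[of W E v]
    by (auto simp: mtrace_def markov_mat_index pick_in_set intro!: sum.cong)
  then show ?thesis by (simp add: sum_pick[OF assms(1), of "\<lambda>a _. 1 / v a"])
qed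

text \<open>The trace runs over closed walks of two steps. By symmetry the return step exists
  whenever the outward one does, so each ordered pair in \<open>E\<close>, loops included,
  contributes exactly once.\<close>

lemma mtrace_markov_mat_square:
  assumes W: "finite W" and E: "E \<subseteq> W \<times> W" "sym E"
  shows "mtrace (markov_mat W E v * markov_mat W E v) = (\<Sum>(a, b)\<in>E. 1 / (v a * v b))"
proof -
  let ?M = "markov_mat W E v"
  have "mtrace (?M * ?M) = (\<Sum>i<card W. \<Sum>j<card W. ?M $$ (i, j) * ?M $$ (j, i))"
    using markov_mat_carrier[of W E v]
    by (auto simp: mtrace_def scalar_prod_def atLeast0LessThan intro!: sum.cong)
  also have "\<dots> = (\<Sum>i<card W. \<Sum>j<card W. if (pick W i, pick W j) \<in> E
      then 1 / (v (pick W i) * v (pick W j)) else 0)"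
    using symD[OF E(2)] by (intro sum.cong refl) (auto simp: markov_mat_index)
  also have "\<dots> = (\<Sum>a\<in>W. \<Sum>b\<in>W. if (a, b) \<in> E then 1 / (v a * v b) else 0)"
    by (simp add: sum_pick[OF W, of "\<lambda>b _. if (_, b) \<in> E then 1 / (_ * v b) else 0"]
        sum_pick[OF W, of "\<lambda>a _. \<Sum>b\<in>W. if (a, b) \<in> E then 1 / (v a * v b) else 0"])
  also have "\<dots> = (\<Sum>(a, b)\<in>W \<times> W. if (a, b) \<in> E then 1 / (v a * v b) else 0)"
    using W by (simp add: sum.cartesian_product)
  also have "\<dots> = (\<Sum>(a, b)\<in>E. 1 / (v a * v b))"
    using W E(1) by (intro sum.mono_neutral_cong_right) auto
  finally show ?thesis .
qed

section \<open>Assembling the component bases\<close>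

text \<open>A coordinatewise criterion, which allows relations to be transferred between dimensions
  \<open>card W\<close> and \<open>card C\<close>. Coefficients given on a subset are extended by
  0.\<close>

lemma lin_dep_finite_iff:
  assumes S: "finite S" "S \<subseteq> carrier_vec n"
  shows "module.lin_dep class_ring (module_vec TYPE('a :: field) n) S \<longleftrightarrow>
    (\<exists>a. (\<forall>i<n. (\<Sum>x\<in>S. a x * x $ i) = 0) \<and> (\<exists>x\<in>S. a x \<noteq> 0))"
    (is "_ \<longleftrightarrow> ?R")
proof -
  interpret vec_space "TYPE('a)" n .
  have zero: "lincomb a A = 0\<^sub>v n \<longleftrightarrow> (\<forall>i<n. (\<Sum>x\<in>A. a x * x $ i) = 0)"
    if "A \<subseteq> carrier_vec n" "finite A" for a A
  proof -
    have "lincomb a A = 0\<^sub>v n \<longleftrightarrow> (\<forall>i<n. lincomb a A $ i = 0)"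
      using lincomb_dim[OF that(2,1), of a] by (auto intro!: eq_vecI)
    then show ?thesis using that by (simp add: lincomb_index)
  qed
  show ?thesis
  proof
    assume "lin_dep S"
    then obtain A a x where A: "finite A" "A \<subseteq> S" "lincomb a A = 0\<^sub>v n" "x \<in> A" "a x \<noteq> 0"
      by (auto simp: lin_dep_def)
    have "(\<Sum>y\<in>S. (if y \<in> A then a y else 0) * y $ i) = (\<Sum>y\<in>A. a y * y $ i)" for i
      using A S by (intro sum.mono_neutral_cong_right) auto
    then show ?R
      using A S zero[of A a] by (intro exI[of _ "\<lambda>y. if y \<in> A then a y else 0"]) auto
  next
    assume ?R
    then show "lin_dep S"
      using S zero[of S] unfolding lin_dep_def by auto
  qed
qed

lemma basis_card:
  assumes "vectorspace.basis class_ring (module_vec TYPE('a :: field) n) S"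
  shows "S \<subseteq> carrier_vec n" "finite S" "card S = n"
    "\<not> module.lin_dep class_ring (module_vec TYPE('a) n) S"
proof -
  interpret vec_space "TYPE('a)" n .
  show S: "S \<subseteq> carrier_vec n" "\<not> lin_dep S" using assms by (auto simp: basis_def)
  show "finite S" using fin_dim_li_fin[OF fin_dim S(2)] S(1) by simp
  then show "card S = n" using dim_basis[OF _ assms] dim_is_n by simp
qed

text \<open>Works for any partition into parts that no edge enters from outside. Restricting a
  relation among padded vectors to the positions of \<open>C\<close> leaves a relation within
  \<open>B C\<close>, which must be trivial.\<close>

lemma complete_eigenvectors_components:
  assumes W: "finite W" and part: "\<Union>\<C> = W" "disjoint \<C>"
    and closed: "\<And>a b C. C \<in> \<C> \<Longrightarrow> (a, b) \<in> E \<Longrightarrow> a \<in> W \<Longrightarrow> b \<in> C \<Longrightarrow> a \<in> C"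
    and B: "\<And>C. C \<in> \<C> \<Longrightarrow> complete_eigenvectors (component_mat E v C) (B C)"
  shows "complete_eigenvectors (markov_mat W E v) (\<Union>C\<in>\<C>. zero_extend W C ` B C)"
    (is "complete_eigenvectors _ ?U")
proof -
  have sub: "C \<subseteq> W" if "C \<in> \<C>" for C using part that by auto
  have fin: "finite C" if "C \<in> \<C>" for C
    using W finite_subset[OF sub[OF that]] by auto
  have finC: "finite \<C>" using part(1) W finite_UnionD by auto
  have basis: "vectorspace.basis class_ring (module_vec TYPE(real) (card C)) (B C)" if "C \<in> \<C>" for C
    using B[OF that] by (simp add: complete_eigenvectors_def component_mat_def)
  note bas = basis_card[OF basis]
  have inj: "inj_on (zero_extend W C) (B C)" if "C \<in> \<C>" for C
    using zero_extend_inj[OF W sub[OF that]] bas(1)[OF that] by (auto intro!: inj_onI)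
  have outside: "zero_extend W D y $ card {b \<in> W. b < a} = 0"
    if "C \<in> \<C>" "D \<in> \<C>" "C \<noteq> D" "a \<in> C" for C D y a
  proof -
    have "a \<in> W" "a \<notin> D" using disjointD[OF part(2) that(1-3)] that(4) sub[OF that(1)] by auto
    then show ?thesis using W by (simp add: zero_extend_index)
  qed
  have inside: "zero_extend W C y $ card {b \<in> W. b < pick C i} = y $ i"
    if "C \<in> \<C>" "i < card C" for C y i
    using pick_in_set[of i C] sub[OF that(1)] that W by (auto simp: zero_extend_index card_pick)
  have nz: "x \<noteq> 0\<^sub>v (card C)" if "C \<in> \<C>" "x \<in> B C" for C x
    using B[OF that(1)] that(2) by (auto simp: complete_eigenvectors_def eigenvector_def component_mat_def)
  \<comment> \<open>A vector padded from both \<open>C\<close> and \<open>D\<close> would vanish on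
    \<open>C\<close>, hence come from the zero vector, which is no eigenvector.\<close>
  have disj: "zero_extend W C ` B C \<inter> zero_extend W D ` B D = {}"
    if CD: "C \<in> \<C>" "D \<in> \<C>" "C \<noteq> D" for C D
  proof -
    have False if "x \<in> B C" "zero_extend W C x = zero_extend W D y" for x y
    proof -
      have "x $ i = 0" if "i < card C" for i
        using inside[OF CD(1) that, of x] outside[OF CD, of "pick C i" y] pick_in_set[of i C] that
        by (simp add: \<open>zero_extend W C x = zero_extend W D y\<close>)
      then have "x = 0\<^sub>v (card C)" using bas(1)[OF CD(1)] that(1) by (intro eq_vecI) auto
      then show False using nz[OF CD(1) that(1)] by simp
    qed
    then show ?thesis by blast
  qed
  have finU: "finite ?U" using finC bas(2) by auto
  have "card ?U = (\<Sum>C\<in>\<C>. card (zero_extend W C ` B C))"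
    using finC bas(2) disj by (intro card_UN_disjoint) auto
  also have "\<dots> = (\<Sum>C\<in>\<C>. card C)" using bas(3) inj by (simp add: card_image)
  also have "\<dots> = card W"
    using card_Union_disjoint[of \<C>] part fin by (simp add: disjoint_def pairwise_def disjnt_def)
  finally have cardU: "card ?U = card W" .
  have carU: "?U \<subseteq> carrier_vec (card W)" by auto
  have "\<not> module.lin_dep class_ring (module_vec TYPE(real) (card W)) ?U"
  proof
    assume "module.lin_dep class_ring (module_vec TYPE(real) (card W)) ?U"
    then obtain a C x where a: "\<And>p. p < card W \<Longrightarrow> (\<Sum>y\<in>?U. a y * y $ p) = 0"
      and C: "C \<in> \<C>" "x \<in> B C" "a (zero_extend W C x) \<noteq> 0"
      unfolding lin_dep_finite_iff[OF finU carU] by blast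
    have "(\<Sum>y\<in>B C. a (zero_extend W C y) * y $ i) = 0" if i: "i < card C" for i
    proof -
      define p where "p = card {b \<in> W. b < pick C i}"
      have pC: "pick C i \<in> C" using i by (simp add: pick_in_set)
      have "p < card W" using rank_less_card[OF W] pC sub[OF C(1)] by (auto simp: p_def)
      then have "0 = (\<Sum>y\<in>?U. a y * y $ p)" by (simp add: a)
      also have "\<dots> = (\<Sum>y\<in>zero_extend W C ` B C. a y * y $ p)"
        using finU C(1) outside[OF C(1) _ _ pC]
        by (intro sum.mono_neutral_right) (auto simp: p_def)
      also have "\<dots> = (\<Sum>y\<in>B C. a (zero_extend W C y) * zero_extend W C y $ p)"
        by (simp add: sum.reindex[OF inj[OF C(1)]])
      also have "\<dots> = (\<Sum>y\<in>B C. a (zero_extend W C y) * y $ i)"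
        using inside[OF C(1) i] by (simp add: p_def)
      finally show ?thesis by simp
    qed
    then have "module.lin_dep class_ring (module_vec TYPE(real) (card C)) (B C)"
      unfolding lin_dep_finite_iff[OF bas(2)[OF C(1)] bas(1)[OF C(1)]] using C(2,3)
      by (intro exI[of _ "\<lambda>y. a (zero_extend W C y)"]) auto
    then show False using bas(4)[OF C(1)] by simp
  qed
  then have "vectorspace.basis class_ring (module_vec TYPE(real) (card W)) ?U"
    using basis_if_lin_indpt_card[OF carU cardU finU] by simp
  moreover have "\<exists>k. eigenvector (markov_mat W E v) z k" if "z \<in> ?U" for z
  proof -
    obtain C x where C: "C \<in> \<C>" "x \<in> B C" "z = zero_extend W C x" using \<open>z \<in> ?U\<close> by blast
    then obtain k where k: "eigenvector (component_mat E v C) x k"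
      using B[OF C(1)] by (auto simp: complete_eigenvectors_def)
    have "eigenvector (markov_mat W E v) z k"
      unfolding C(3) by (rule eigenvector_zero_extend[OF W sub[OF C(1)] closed[OF C(1)] k])
    then show ?thesis ..
  qed
  ultimately show ?thesis by (simp add: complete_eigenvectors_def)
qed

text \<open>Symmetry makes reachability an equivalence on \<open>W\<close> and lets the edge be
  walked back from \<open>b\<close> to \<open>a\<close>, so the class of \<open>b\<close> contains
  \<open>a\<close>.\<close>

lemma conn_components_partition:
  assumes "sym E"
  shows "\<Union>(conn_components W E) = W" "disjoint (conn_components W E)"
    and "C \<in> conn_components W E \<Longrightarrow> (a, b) \<in> E \<Longrightarrow> a \<in> W \<Longrightarrow> b \<in> C \<Longrightarrow> a \<in> C"
proof -
  have eq: "equiv W (Restr (E\<^sup>*) W)"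
    using symD[OF sym_rtrancl[OF assms]]
    by (intro equivI refl_onI symI transI) (auto intro: rtrancl_trans)
  show "\<Union>(conn_components W E) = W"
    unfolding conn_components_def using Union_quotient[OF eq] .
  show "disjoint (conn_components W E)"
    unfolding conn_components_def using quotient_disj[OF eq] by (auto simp: disjoint_def)
  show "a \<in> C" if "C \<in> conn_components W E" "(a, b) \<in> E" "a \<in> W" "b \<in> C"
    using that symD[OF assms that(2)]
    by (auto simp: conn_components_def quotient_def intro: rtrancl_into_rtrancl)
qed

section \<open>Mean, standard deviation and the final statement\<close>

lemma sum_mset_square_deviation:
  "(\<Sum>k\<in>#X. (k - m)\<^sup>2) = (\<Sum>k\<in>#X. k\<^sup>2) - 2 * m * sum_mset X + real (size X) * m\<^sup>2"
  for m :: real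
proof (induction X)
  case empty
  show ?case by simp
next
  case (add x X)
  have "(x - m)\<^sup>2 = x\<^sup>2 - 2 * m * x + m\<^sup>2" by (simp add: power2_eq_square algebra_simps)
  with add.IH have "(x - m)\<^sup>2 + (\<Sum>k\<in>#X. (k - m)\<^sup>2) =
      x\<^sup>2 + (\<Sum>k\<in>#X. k\<^sup>2) - 2 * m * (x + sum_mset X) + (1 + real (size X)) * m\<^sup>2"
    by (simp only: distrib_left distrib_right)
  then show ?case by simp
qed

theorem proposition3p2:
  fixes N :: nat and E :: "(nat \<times> nat) set" and v :: "nat \<Rightarrow> real"
  defines "M \<equiv> markov_mat {1..N} E v"
  assumes edges: "E \<subseteq> {1..N} \<times> {1..N}"
    and undirected: "sym E"
    and v_pos: "\<And>i. i \<in> {1..N} \<Longrightarrow> 0 < v i"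
  shows
    "(1 < card (conn_components {1..N} E) \<longrightarrow>
        (\<forall>C \<in> conn_components {1..N} E. \<exists>B. complete_eigenvectors (component_mat E v C) B) \<and>
        (\<forall>C \<in> conn_components {1..N} E. \<forall>x k. eigenvector (component_mat E v C) x k \<longrightarrow>
            eigenvector M (zero_extend {1..N} C x) k) \<and>
        (\<forall>B. (\<forall>C \<in> conn_components {1..N} E. complete_eigenvectors (component_mat E v C) (B C)) \<longrightarrow>
            complete_eigenvectors M
              (\<Union>C \<in> conn_components {1..N} E. zero_extend {1..N} C ` B C)))
     \<and> size (eigval_mset M) = N
     \<and> ((\<forall>i \<in> {1..N}. (i, i) \<in> E) \<longrightarrow>
          spec_mean M = 1 / real N * (\<Sum>i = 1..N. 1 / v i))
     \<and> spec_sd M = sqrt (1 / real N * (\<Sum>(i, j) \<in> E. 1 / (v i * v j)) - (spec_mean M)\<^sup>2)"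
proof -
  let ?W = "{1..N}"
  note comp = conn_components_partition[OF undirected, where W = ?W]
  have sub: "C \<subseteq> ?W" if "C \<in> conn_components ?W E" for C using comp(1) that by auto
  have M: "M \<in> carrier_mat N N" "dim_row M = N"
    using markov_mat_carrier[of ?W E v] by (simp_all add: M_def)
  have ex: "\<exists>B. complete_eigenvectors (component_mat E v C) B"
    if C: "C \<in> conn_components ?W E" for C
  proof -
    have "sym (Restr E C)" using undirected by (auto simp: sym_def)
    then obtain d P Q where "similar_mat_wit (component_mat E v C) (mat_diag (card C) d) P Q"
      using markov_mat_similar_diag[of C "Restr E C" v] v_pos sub[OF C] finite_subset[OF sub[OF C]]
      by (auto simp: component_mat_def subset_iff)
    then show ?thesis
      using complete_eigenvectors_similar_diag by (metis component_mat_def markov_mat_carrier)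
  qed
  have ext: "eigenvector M (zero_extend ?W C x) k"
    if "C \<in> conn_components ?W E" "eigenvector (component_mat E v C) x k" for C x k
    unfolding M_def using eigenvector_zero_extend[OF _ sub[OF that(1)] comp(3)[OF that(1)] that(2)]
    by simp
  have union: "complete_eigenvectors M (\<Union>C\<in>conn_components ?W E. zero_extend ?W C ` B C)"
    if "\<forall>C\<in>conn_components ?W E. complete_eigenvectors (component_mat E v C) (B C)" for B
    unfolding M_def using that comp by (intro complete_eigenvectors_components) auto
  obtain d P Q where "similar_mat_wit M (mat_diag N d) P Q"
    using markov_mat_similar_diag[OF _ undirected, of ?W v] v_pos by (auto simp: M_def)
  note ps = eigval_mset_power_sums[OF this M(1)]
  have mean: "spec_mean M = mtrace M / real N" by (simp add: spec_mean_def ps M)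
  have sq: "mtrace (M * M) = (\<Sum>(i, j)\<in>E. 1 / (v i * v j))"
    unfolding M_def using mtrace_markov_mat_square[OF _ edges undirected] by simp
  have dev: "(\<Sum>k\<in>#eigval_mset M. (k - spec_mean M)\<^sup>2) =
      mtrace (M * M) - 2 * spec_mean M * mtrace M + real N * (spec_mean M)\<^sup>2"
    by (simp only: sum_mset_square_deviation ps)
  \<comment> \<open>For \<open>N = 0\<close> both sides are 0, as division by zero yields 0.
    Otherwise \<open>mtrace M\<close> is \<open>N\<close> times the mean, so the last two terms of
    \<open>dev\<close> combine to \<open>-N\<close> times its square.\<close>
  have "(\<Sum>k\<in>#eigval_mset M. (k - spec_mean M)\<^sup>2) / real N =
      1 / real N * mtrace (M * M) - (spec_mean M)\<^sup>2"
    unfolding dev by (cases "N = 0") (simp_all add: mean power2_eq_square field_simps)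
  then have "spec_sd M = sqrt (1 / real N * (\<Sum>(i, j) \<in> E. 1 / (v i * v j)) - (spec_mean M)\<^sup>2)"
    by (simp add: spec_sd_def M sq)
  moreover have "spec_mean M = 1 / real N * (\<Sum>i = 1..N. 1 / v i)" if "\<forall>i\<in>?W. (i, i) \<in> E"
    using mtrace_markov_mat[of ?W E v] that by (simp add: mean) (simp add: M_def)
  ultimately show ?thesis using ex ext union ps(1) by blast
qed

end
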